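(* Let $(F:\mathcal C\to\mathcal D,\ G:\mathcal D\to\mathcal C)$ be an adjoint pair ($F$ left adjoint to $G$) with unit $\eta$ and counit $\varepsilon$, and let $I:\mathcal C\to\mathcal X$ be a functor. Let $\mathbf T$ be the monad on $\mathcal C$ defined by the adjunction $(F,G)$. Then the following are equivalent: (1) The functor $F$ is heavily $I$-separable. (2) For any $\mathbf T$-adjunction $(F':\mathcal C\to\mathcal D',\ G':\mathcal D'\to\mathcal C)$, the functor $F'$ is heavily $I$-separable.
   Context: The monad defined by an adjunction $(F,G)$ with unit $\eta:1_{\mathcal C}\to GF$ and counit $\varepsilon:FG\to1_{\mathcal D}$ is $(GF,\ G\varepsilon F,\ \eta)$ (endofunctor, multiplication, unit). Given a monad $\mathbf T$ on $\mathcal C$, a $\mathbf T$-adjunction is an adjoint pair $(F':\mathcal C\to\mathcal D',G':\mathcal D'\to\mathcal C)$ whose associated monad $(G'F',G'\varepsilon'F',\eta')$ is equal to $\mathbf T$. Definition (heavy $I$-separability). Let $F:\mathcal C\to\mathcal D$ and $I:\mathcal C\to\mathcal X$ be functors. $F$ is heavily $I$-separable if there is a natural transformation $P:\mathcal D(F(-),F(-))\to\mathcal X(I(-),I(-))$ of functors $\mathcal C^{op}\times\mathcal C\to \mathrm{Set}$ such that (a) $P_{a,b}(F(f))=I(f)$ for all $f\in\mathcal C(a,b)$; and (b) $P_{a,c}(g\circ f)=P_{b,c}(g)\circ P_{a,b}(f)$ for all $f\in\mathcal D(Fa,Fb)$, $g\in\mathcal D(Fb,Fc)$. *)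

theory Defs
  imports "HOL-Library.FuncSet"
begin

section \<open>Categories, functors, natural transformations\<close>

text \<open>
  A category has carriers of objects and of arrows inside HOL types. Values of its operations, and
  of functors and natural transformations, outside the carriers are junk; in particular
  \<open>g \<cdot>\<^bsub>C\<^esub> f\<close> is meaningful only if \<open>f\<close> and \<open>g\<close> are composable. The order is that of \<open>g \<circ> f\<close>.
\<close>

record ('o, 'a) cat =
  Ob :: "'o set"
  Ar :: "'a set"
  Dom :: "'a \<Rightarrow> 'o"
  Cod :: "'a \<Rightarrow> 'o"
  Ident :: "'o \<Rightarrow> 'a"
  Comp :: "'a \<Rightarrow> 'a \<Rightarrow> 'a" (infixr "\<cdot>\<index>" 70)

definition hom :: "('o, 'a) cat \<Rightarrow> 'o \<Rightarrow> 'o \<Rightarrow> 'a set" where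
  "hom C a b = {f \<in> Ar C. Dom C f = a \<and> Cod C f = b}"

locale category =
  fixes C :: "('o, 'a) cat"
  assumes Dom_Ob: "f \<in> Ar C \<Longrightarrow> Dom C f \<in> Ob C"
    and Cod_Ob: "f \<in> Ar C \<Longrightarrow> Cod C f \<in> Ob C"
    and Ident_hom: "a \<in> Ob C \<Longrightarrow> Ident C a \<in> hom C a a"
    and Comp_hom: "\<lbrakk>f \<in> hom C a b; g \<in> hom C b c\<rbrakk> \<Longrightarrow> g \<cdot>\<^bsub>C\<^esub> f \<in> hom C a c"
    and Comp_Ident: "f \<in> hom C a b \<Longrightarrow> f \<cdot>\<^bsub>C\<^esub> Ident C a = f"
    and Ident_Comp: "f \<in> hom C a b \<Longrightarrow> Ident C b \<cdot>\<^bsub>C\<^esub> f = f"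
    and Comp_assoc: "\<lbrakk>f \<in> hom C a b; g \<in> hom C b c; h \<in> hom C c d\<rbrakk>
      \<Longrightarrow> (h \<cdot>\<^bsub>C\<^esub> g) \<cdot>\<^bsub>C\<^esub> f = h \<cdot>\<^bsub>C\<^esub> (g \<cdot>\<^bsub>C\<^esub> f)"

record ('o, 'a, 'p, 'b) fctr =
  FOb :: "'o \<Rightarrow> 'p"
  FAr :: "'a \<Rightarrow> 'b"

locale cat_functor = C: category C + D: category D
  for C :: "('o, 'a) cat" and D :: "('p, 'b) cat" +
  fixes F :: "('o, 'a, 'p, 'b) fctr"
  assumes FOb_Ob: "a \<in> Ob C \<Longrightarrow> FOb F a \<in> Ob D"
    and FAr_hom: "f \<in> hom C a b \<Longrightarrow> FAr F f \<in> hom D (FOb F a) (FOb F b)"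
    and FAr_Ident: "a \<in> Ob C \<Longrightarrow> FAr F (Ident C a) = Ident D (FOb F a)"
    and FAr_Comp: "\<lbrakk>f \<in> hom C a b; g \<in> hom C b c\<rbrakk>
      \<Longrightarrow> FAr F (g \<cdot>\<^bsub>C\<^esub> f) = FAr F g \<cdot>\<^bsub>D\<^esub> FAr F f"

definition id_fctr :: "('o, 'a, 'o, 'a) fctr" where
  "id_fctr = \<lparr>FOb = (\<lambda>a. a), FAr = (\<lambda>f. f)\<rparr>"

definition comp_fctr ::
    "('p, 'b, 'q, 'c) fctr \<Rightarrow> ('o, 'a, 'p, 'b) fctr \<Rightarrow> ('o, 'a, 'q, 'c) fctr"
    (infixr "\<cdot>\<^sub>F" 70) where
  "G \<cdot>\<^sub>F F = \<lparr>FOb = (\<lambda>a. FOb G (FOb F a)), FAr = (\<lambda>f. FAr G (FAr F f))\<rparr>"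

locale nat_transform = F: cat_functor C D F + G: cat_functor C D G
  for C :: "('o, 'a) cat" and D :: "('p, 'b) cat"
    and F G :: "('o, 'a, 'p, 'b) fctr" +
  fixes \<tau> :: "'o \<Rightarrow> 'b"
  assumes component: "a \<in> Ob C \<Longrightarrow> \<tau> a \<in> hom D (FOb F a) (FOb G a)"
    and naturality: "f \<in> hom C a b \<Longrightarrow> \<tau> b \<cdot>\<^bsub>D\<^esub> FAr F f = FAr G f \<cdot>\<^bsub>D\<^esub> \<tau> a"


section \<open>Adjunctions and monads\<close>

locale adjunction =
  F: cat_functor C D F + G: cat_functor D C G +
  unit: nat_transform C C id_fctr "G \<cdot>\<^sub>F F" \<eta> +
  counit: nat_transform D D "F \<cdot>\<^sub>F G" id_fctr \<epsilon>
  for C :: "('o, 'a) cat" and D :: "('p, 'b) cat"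
    and F :: "('o, 'a, 'p, 'b) fctr" and G :: "('p, 'b, 'o, 'a) fctr"
    and \<eta> :: "'o \<Rightarrow> 'a" and \<epsilon> :: "'p \<Rightarrow> 'b" +
  assumes triangle_F: "a \<in> Ob C \<Longrightarrow> \<epsilon> (FOb F a) \<cdot>\<^bsub>D\<^esub> FAr F (\<eta> a) = Ident D (FOb F a)"
    and triangle_G: "d \<in> Ob D \<Longrightarrow> FAr G (\<epsilon> d) \<cdot>\<^bsub>C\<^esub> \<eta> (FOb G d) = Ident C (FOb G d)"

record ('o, 'a) mnd =
  Endo :: "('o, 'a, 'o, 'a) fctr"
  Mult :: "'o \<Rightarrow> 'a"
  Unity :: "'o \<Rightarrow> 'a"

locale cat_monad =
  Endo: cat_functor C C "Endo T" +
  Mult: nat_transform C C "Endo T \<cdot>\<^sub>F Endo T" "Endo T" "Mult T" +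
  Unity: nat_transform C C id_fctr "Endo T" "Unity T"
  for C :: "('o, 'a) cat" and T :: "('o, 'a) mnd" +
  assumes Mult_assoc: "a \<in> Ob C \<Longrightarrow>
      Mult T a \<cdot>\<^bsub>C\<^esub> Mult T (FOb (Endo T) a) = Mult T a \<cdot>\<^bsub>C\<^esub> FAr (Endo T) (Mult T a)"
    and Mult_Unity_left: "a \<in> Ob C \<Longrightarrow>
      Mult T a \<cdot>\<^bsub>C\<^esub> Unity T (FOb (Endo T) a) = Ident C (FOb (Endo T) a)"
    and Mult_Unity_right: "a \<in> Ob C \<Longrightarrow>
      Mult T a \<cdot>\<^bsub>C\<^esub> FAr (Endo T) (Unity T a) = Ident C (FOb (Endo T) a)"

definition monad_of_adjunction ::
    "('o, 'a, 'p, 'b) fctr \<Rightarrow> ('p, 'b, 'o, 'a) fctr \<Rightarrow> ('o \<Rightarrow> 'a) \<Rightarrow> ('p \<Rightarrow> 'b) \<Rightarrow> ('o, 'a) mnd" where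
  "monad_of_adjunction F G \<eta> \<epsilon> =
    \<lparr>Endo = G \<cdot>\<^sub>F F, Mult = (\<lambda>a. FAr G (\<epsilon> (FOb F a))), Unity = \<eta>\<rparr>"

text \<open>Equality of monads on \<open>C\<close>; HOL equality would also compare the junk values off the carriers.\<close>

definition monad_eq :: "('o, 'a) cat \<Rightarrow> ('o, 'a) mnd \<Rightarrow> ('o, 'a) mnd \<Rightarrow> bool" where
  "monad_eq C S T \<longleftrightarrow>
    (\<forall>a\<in>Ob C. FOb (Endo S) a = FOb (Endo T) a) \<and>
    (\<forall>f\<in>Ar C. FAr (Endo S) f = FAr (Endo T) f) \<and>
    (\<forall>a\<in>Ob C. Mult S a = Mult T a) \<and>
    (\<forall>a\<in>Ob C. Unity S a = Unity T a)"

definition monad_adjunction ::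
    "('o, 'a) cat \<Rightarrow> ('o, 'a) mnd \<Rightarrow> ('p, 'b) cat \<Rightarrow> ('o, 'a, 'p, 'b) fctr \<Rightarrow> ('p, 'b, 'o, 'a) fctr
      \<Rightarrow> ('o \<Rightarrow> 'a) \<Rightarrow> ('p \<Rightarrow> 'b) \<Rightarrow> bool" where
  "monad_adjunction C T D F G \<eta> \<epsilon> \<longleftrightarrow>
    adjunction C D F G \<eta> \<epsilon> \<and> monad_eq C (monad_of_adjunction F G \<eta> \<epsilon>) T"


section \<open>Set-valued functors and heavy separability\<close>

text \<open>
  A functor to \<open>Set\<close> takes values in the subsets of one HOL type \<open>'s\<close>, and a natural
  transformation between two such functors may change this type.
\<close>

record ('o, 'a, 's) set_fctr =
  SOb :: "'o \<Rightarrow> 's set"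
  SAr :: "'a \<Rightarrow> 's \<Rightarrow> 's"

locale set_functor = category A for A :: "('o, 'a) cat" +
  fixes S :: "('o, 'a, 's) set_fctr"
  assumes SAr_fun: "f \<in> hom A a b \<Longrightarrow> SAr S f \<in> SOb S a \<rightarrow> SOb S b"
    and SAr_Ident: "\<lbrakk>a \<in> Ob A; x \<in> SOb S a\<rbrakk> \<Longrightarrow> SAr S (Ident A a) x = x"
    and SAr_Comp: "\<lbrakk>f \<in> hom A a b; g \<in> hom A b c; x \<in> SOb S a\<rbrakk>
      \<Longrightarrow> SAr S (g \<cdot>\<^bsub>A\<^esub> f) x = SAr S g (SAr S f x)"

locale set_nat_transform = S: set_functor A S + T: set_functor A T
  for A :: "('o, 'a) cat" and S :: "('o, 'a, 's) set_fctr" and T :: "('o, 'a, 't) set_fctr" +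
  fixes \<tau> :: "'o \<Rightarrow> 's \<Rightarrow> 't"
  assumes component: "a \<in> Ob A \<Longrightarrow> \<tau> a \<in> SOb S a \<rightarrow> SOb T a"
    and naturality: "\<lbrakk>f \<in> hom A a b; x \<in> SOb S a\<rbrakk> \<Longrightarrow> \<tau> b (SAr S f x) = SAr T f (\<tau> a x)"

definition op_cat :: "('o, 'a) cat \<Rightarrow> ('o, 'a) cat" where
  "op_cat C = \<lparr>Ob = Ob C, Ar = Ar C, Dom = Cod C, Cod = Dom C, Ident = Ident C,
    Comp = (\<lambda>g f. f \<cdot>\<^bsub>C\<^esub> g)\<rparr>"

definition prod_cat :: "('o, 'a) cat \<Rightarrow> ('p, 'b) cat \<Rightarrow> ('o \<times> 'p, 'a \<times> 'b) cat" where
  "prod_cat C D = \<lparr>Ob = Ob C \<times> Ob D, Ar = Ar C \<times> Ar D,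
    Dom = (\<lambda>(f, g). (Dom C f, Dom D g)), Cod = (\<lambda>(f, g). (Cod C f, Cod D g)),
    Ident = (\<lambda>(a, b). (Ident C a, Ident D b)),
    Comp = (\<lambda>(g, g') (f, f'). (g \<cdot>\<^bsub>C\<^esub> f, g' \<cdot>\<^bsub>D\<^esub> f'))\<rparr>"

text \<open>The functor \<open>D(F(-), F(-))\<close> on \<open>prod_cat (op_cat C) C\<close>.\<close>

definition hom_fctr ::
    "('p, 'b) cat \<Rightarrow> ('o, 'a, 'p, 'b) fctr \<Rightarrow> ('o \<times> 'o, 'a \<times> 'a, 'b) set_fctr" where
  "hom_fctr D F = \<lparr>SOb = (\<lambda>(a, b). hom D (FOb F a) (FOb F b)),
    SAr = (\<lambda>(u, v) g. FAr F v \<cdot>\<^bsub>D\<^esub> g \<cdot>\<^bsub>D\<^esub> FAr F u)\<rparr>"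

definition heavily_separable ::
    "('o, 'a) cat \<Rightarrow> ('p, 'b) cat \<Rightarrow> ('q, 'c) cat \<Rightarrow> ('o, 'a, 'p, 'b) fctr \<Rightarrow> ('o, 'a, 'q, 'c) fctr
      \<Rightarrow> bool" where
  "heavily_separable C D X F I \<longleftrightarrow>
    (\<exists>P. set_nat_transform (prod_cat (op_cat C) C) (hom_fctr D F) (hom_fctr X I) P \<and>
      (\<forall>a\<in>Ob C. \<forall>b\<in>Ob C. \<forall>f\<in>hom C a b. P (a, b) (FAr F f) = FAr I f) \<and>
      (\<forall>a\<in>Ob C. \<forall>b\<in>Ob C. \<forall>c\<in>Ob C.
        \<forall>f\<in>hom D (FOb F a) (FOb F b). \<forall>g\<in>hom D (FOb F b) (FOb F c).
          P (a, c) (g \<cdot>\<^bsub>D\<^esub> f) = P (b, c) g \<cdot>\<^bsub>X\<^esub> P (a, b) f))"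


section \<open>Well-formedness of the constructions\<close>

lemma category_op_cat: "category C \<Longrightarrow> category (op_cat C)"
  unfolding category_def op_cat_def hom_def by auto

lemma category_prod_cat: "category C \<Longrightarrow> category D \<Longrightarrow> category (prod_cat C D)"
  unfolding category_def prod_cat_def hom_def by auto

lemma set_functor_hom_fctr:
  assumes "cat_functor C D F"
  shows "set_functor (prod_cat (op_cat C) C) (hom_fctr D F)"
proof -
  interpret F: cat_functor C D F by fact
  have homI: "u \<in> hom C a' a \<and> v \<in> hom C b b'"
    if "(u, v) \<in> hom (prod_cat (op_cat C) C) (a, b) (a', b')" for u v a b a' b'
    using that by (auto simp: prod_cat_def op_cat_def hom_def)
  have [simp]: "Ob (prod_cat (op_cat C) C) = Ob C \<times> Ob C"
    "Ident (prod_cat (op_cat C) C) (a, b) = (Ident C a, Ident C b)"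
    "(u', v') \<cdot>\<^bsub>prod_cat (op_cat C) C\<^esub> (u, v) = (u \<cdot>\<^bsub>C\<^esub> u', v' \<cdot>\<^bsub>C\<^esub> v)" for a b u v u' v'
    by (auto simp: prod_cat_def op_cat_def)
  have act: "FAr F v \<cdot>\<^bsub>D\<^esub> x \<cdot>\<^bsub>D\<^esub> FAr F u \<in> hom D (FOb F a') (FOb F b')"
    if "u \<in> hom C a' a" "v \<in> hom C b b'" "x \<in> hom D (FOb F a) (FOb F b)" for u v a b a' b' x
    using that by (meson F.D.Comp_hom F.FAr_hom)
  have comp: "FAr F (v' \<cdot>\<^bsub>C\<^esub> v) \<cdot>\<^bsub>D\<^esub> x \<cdot>\<^bsub>D\<^esub> FAr F (u \<cdot>\<^bsub>C\<^esub> u')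
      = FAr F v' \<cdot>\<^bsub>D\<^esub> (FAr F v \<cdot>\<^bsub>D\<^esub> x \<cdot>\<^bsub>D\<^esub> FAr F u) \<cdot>\<^bsub>D\<^esub> FAr F u'"
    if u: "u \<in> hom C a' a" "u' \<in> hom C a'' a'" and v: "v \<in> hom C b b'" "v' \<in> hom C b' b''"
      and x: "x \<in> hom D (FOb F a) (FOb F b)" for u v a b a' b' a'' b'' u' v' x
  proof -
    note U = F.FAr_hom[OF u(1)] F.FAr_hom[OF u(2)]
    note V = F.FAr_hom[OF v(1)] F.FAr_hom[OF v(2)]
    have "FAr F (v' \<cdot>\<^bsub>C\<^esub> v) \<cdot>\<^bsub>D\<^esub> x \<cdot>\<^bsub>D\<^esub> FAr F (u \<cdot>\<^bsub>C\<^esub> u')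
        = (FAr F v' \<cdot>\<^bsub>D\<^esub> FAr F v) \<cdot>\<^bsub>D\<^esub> x \<cdot>\<^bsub>D\<^esub> (FAr F u \<cdot>\<^bsub>D\<^esub> FAr F u')"
      using u v by (simp add: F.FAr_Comp)
    also have "\<dots> = (FAr F v' \<cdot>\<^bsub>D\<^esub> FAr F v) \<cdot>\<^bsub>D\<^esub> ((x \<cdot>\<^bsub>D\<^esub> FAr F u) \<cdot>\<^bsub>D\<^esub> FAr F u')"
      by (simp add: F.D.Comp_assoc[OF U(2) U(1) x])
    also have "\<dots> = FAr F v' \<cdot>\<^bsub>D\<^esub> (FAr F v \<cdot>\<^bsub>D\<^esub> ((x \<cdot>\<^bsub>D\<^esub> FAr F u) \<cdot>\<^bsub>D\<^esub> FAr F u'))"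
      by (meson F.D.Comp_assoc F.D.Comp_hom U V x)
    also have "FAr F v \<cdot>\<^bsub>D\<^esub> ((x \<cdot>\<^bsub>D\<^esub> FAr F u) \<cdot>\<^bsub>D\<^esub> FAr F u')
        = (FAr F v \<cdot>\<^bsub>D\<^esub> x \<cdot>\<^bsub>D\<^esub> FAr F u) \<cdot>\<^bsub>D\<^esub> FAr F u'"
      by (metis F.D.Comp_assoc F.D.Comp_hom U V(1) x)
    finally show ?thesis .
  qed
  have ident: "FAr F (Ident C b) \<cdot>\<^bsub>D\<^esub> x \<cdot>\<^bsub>D\<^esub> FAr F (Ident C a) = x"
    if "a \<in> Ob C" "b \<in> Ob C" "x \<in> hom D (FOb F a) (FOb F b)" for a b x
    using that by (simp add: F.FAr_Ident F.D.Comp_Ident F.D.Ident_Comp)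
  interpret P: category "prod_cat (op_cat C) C"
    by (intro category_prod_cat category_op_cat F.C.category_axioms)
  show ?thesis
  proof
    fix f a b assume f: "f \<in> hom (prod_cat (op_cat C) C) a b"
    show "SAr (hom_fctr D F) f \<in> SOb (hom_fctr D F) a \<rightarrow> SOb (hom_fctr D F) b"
      using f act by (cases f, cases a, cases b) (auto simp: hom_fctr_def dest!: homI)
  next
    fix a x assume "a \<in> Ob (prod_cat (op_cat C) C)" "x \<in> SOb (hom_fctr D F) a"
    then show "SAr (hom_fctr D F) (Ident (prod_cat (op_cat C) C) a) x = x"
      by (cases a) (auto simp: hom_fctr_def ident)
  next
    fix f a b g c x
    assume "f \<in> hom (prod_cat (op_cat C) C) a b" "g \<in> hom (prod_cat (op_cat C) C) b c"
      "x \<in> SOb (hom_fctr D F) a"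
    then show "SAr (hom_fctr D F) (g \<cdot>\<^bsub>prod_cat (op_cat C) C\<^esub> f) x
        = SAr (hom_fctr D F) g (SAr (hom_fctr D F) f x)"
      by (cases f, cases g, cases a, cases b, cases c)
        (auto simp: hom_fctr_def dest!: homI intro!: comp)
  qed
qed

lemma (in category) id_functor: "cat_functor C C id_fctr"
  by unfold_locales (auto simp: id_fctr_def)

lemma comp_functor:
  assumes "cat_functor C D F" "cat_functor D E G"
  shows "cat_functor C E (G \<cdot>\<^sub>F F)"
proof -
  interpret F: cat_functor C D F by fact
  interpret G: cat_functor D E G by fact
  show ?thesis
    by unfold_locales
      (auto simp: comp_fctr_def F.FOb_Ob G.FOb_Ob F.FAr_Ident G.FAr_Ident F.FAr_Comp
        intro: F.FAr_hom G.FAr_hom G.FAr_Comp)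
qed

lemma (in adjunction) cat_monad_of_adjunction:
  "cat_monad C (monad_of_adjunction F G \<eta> \<epsilon>)"
proof -
  let ?T = "monad_of_adjunction F G \<eta> \<epsilon>"
  have E: "Endo ?T = G \<cdot>\<^sub>F F" and M: "Mult ?T = (\<lambda>a. FAr G (\<epsilon> (FOb F a)))" and U: "Unity ?T = \<eta>"
    by (simp_all add: monad_of_adjunction_def)
  have eps: "\<epsilon> d \<in> hom D (FOb F (FOb G d)) d" if "d \<in> Ob D" for d
    using counit.component[OF that] by (simp add: comp_fctr_def id_fctr_def)
  have nat: "\<epsilon> e \<cdot>\<^bsub>D\<^esub> FAr F (FAr G g) = g \<cdot>\<^bsub>D\<^esub> \<epsilon> d" if "g \<in> hom D d e" for g d e
    using counit.naturality[OF that] by (simp add: comp_fctr_def id_fctr_def)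
  have GF: "cat_functor C C (G \<cdot>\<^sub>F F)"
    by (rule comp_functor[OF F.cat_functor_axioms G.cat_functor_axioms])
  have GFGF: "cat_functor C C ((G \<cdot>\<^sub>F F) \<cdot>\<^sub>F (G \<cdot>\<^sub>F F))"
    by (rule comp_functor[OF GF GF])
  have Gnat: "FAr G (\<epsilon> e) \<cdot>\<^bsub>C\<^esub> FAr G (FAr F (FAr G g)) = FAr G g \<cdot>\<^bsub>C\<^esub> FAr G (\<epsilon> d)"
    if g: "g \<in> hom D d e" for g d e
  proof -
    have de: "d \<in> Ob D" "e \<in> Ob D"
      using g F.D.Dom_Ob F.D.Cod_Ob by (auto simp: hom_def)
    have "FAr G (\<epsilon> e) \<cdot>\<^bsub>C\<^esub> FAr G (FAr F (FAr G g)) = FAr G (\<epsilon> e \<cdot>\<^bsub>D\<^esub> FAr F (FAr G g))"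
      by (rule G.FAr_Comp[symmetric, OF F.FAr_hom[OF G.FAr_hom[OF g]] eps[OF de(2)]])
    also have "\<dots> = FAr G g \<cdot>\<^bsub>C\<^esub> FAr G (\<epsilon> d)"
      by (simp add: nat[OF g] G.FAr_Comp[OF eps[OF de(1)] g])
    finally show ?thesis .
  qed
  have mult: "nat_transform C C ((G \<cdot>\<^sub>F F) \<cdot>\<^sub>F (G \<cdot>\<^sub>F F)) (G \<cdot>\<^sub>F F) (\<lambda>a. FAr G (\<epsilon> (FOb F a)))"
    unfolding nat_transform_def nat_transform_axioms_def
    using GF GFGF eps Gnat F.FAr_hom G.FAr_hom F.FOb_Ob by (simp add: comp_fctr_def)
  show ?thesis
    unfolding cat_monad_def cat_monad_axioms_def E M U
  proof (intro conjI allI impI)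
    show "cat_functor C C (G \<cdot>\<^sub>F F)" by (rule GF)
    show "nat_transform C C ((G \<cdot>\<^sub>F F) \<cdot>\<^sub>F (G \<cdot>\<^sub>F F)) (G \<cdot>\<^sub>F F) (\<lambda>a. FAr G (\<epsilon> (FOb F a)))"
      by (rule mult)
    show "nat_transform C C id_fctr (G \<cdot>\<^sub>F F) \<eta>" by (rule unit.nat_transform_axioms)
  next
    fix a assume a: "a \<in> Ob C"
    note Fa = F.FOb_Ob[OF a]
    show "FAr G (\<epsilon> (FOb F a)) \<cdot>\<^bsub>C\<^esub> FAr G (\<epsilon> (FOb F (FOb (G \<cdot>\<^sub>F F) a)))
        = FAr G (\<epsilon> (FOb F a)) \<cdot>\<^bsub>C\<^esub> FAr (G \<cdot>\<^sub>F F) (FAr G (\<epsilon> (FOb F a)))"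
      using Gnat[OF eps[OF Fa]] by (simp add: comp_fctr_def)
    show "FAr G (\<epsilon> (FOb F a)) \<cdot>\<^bsub>C\<^esub> \<eta> (FOb (G \<cdot>\<^sub>F F) a) = Ident C (FOb (G \<cdot>\<^sub>F F) a)"
      using triangle_G[OF Fa] by (simp add: comp_fctr_def)
    have eta: "\<eta> a \<in> hom C a (FOb G (FOb F a))"
      using unit.component[OF a] by (simp add: comp_fctr_def id_fctr_def)
    show "FAr G (\<epsilon> (FOb F a)) \<cdot>\<^bsub>C\<^esub> FAr (G \<cdot>\<^sub>F F) (\<eta> a) = Ident C (FOb (G \<cdot>\<^sub>F F) a)"
      using G.FAr_Comp[OF F.FAr_hom[OF eta] eps[OF Fa]] triangle_F[OF a] G.FAr_Ident[OF Fa]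
      by (simp add: comp_fctr_def)
  qed
qed

end

theory Submission
  imports Defs
begin

text \<open>
  Adjunctions \<open>(F, G)\<close> and \<open>(F', G')\<close> with the same monad have isomorphic Kleisli categories:
  transposing twice gives bijections \<open>D'(F'a, F'b) \<cong> C(a, G'F'b) = C(a, GFb) \<cong> D(Fa, Fb)\<close>. The composite
  \<open>K\<close> respects composition, because \<open>G (K h) = G' h\<close>, and sends \<open>F'f\<close> to \<open>Ff\<close>; so precomposition
  with \<open>K\<close> carries a heavy separability of \<open>F\<close> to one of \<open>F'\<close>.
\<close>

text \<open>Naturality of \<open>P\<close> follows from the conditions (a) and (b).\<close>

lemma heavily_separableI:
  assumes F: "cat_functor C D F" and I: "cat_functor C X I"
    and P_hom: "\<And>a b f. \<lbrakk>a \<in> Ob C; b \<in> Ob C; f \<in> hom D (FOb F a) (FOb F b)\<rbrakk>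
      \<Longrightarrow> P (a, b) f \<in> hom X (FOb I a) (FOb I b)"
    and P_FAr: "\<And>a b f. \<lbrakk>a \<in> Ob C; b \<in> Ob C; f \<in> hom C a b\<rbrakk> \<Longrightarrow> P (a, b) (FAr F f) = FAr I f"
    and P_Comp: "\<And>a b c f g. \<lbrakk>a \<in> Ob C; b \<in> Ob C; c \<in> Ob C;
      f \<in> hom D (FOb F a) (FOb F b); g \<in> hom D (FOb F b) (FOb F c)\<rbrakk>
      \<Longrightarrow> P (a, c) (g \<cdot>\<^bsub>D\<^esub> f) = P (b, c) g \<cdot>\<^bsub>X\<^esub> P (a, b) f"
  shows "heavily_separable C D X F I"
proof -
  interpret F: cat_functor C D F by fact
  have natural: "P (a', b') (FAr F v \<cdot>\<^bsub>D\<^esub> x \<cdot>\<^bsub>D\<^esub> FAr F u) = FAr I v \<cdot>\<^bsub>X\<^esub> P (a, b) x \<cdot>\<^bsub>X\<^esub> FAr I u"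
    if u: "u \<in> hom C a' a" and v: "v \<in> hom C b b'" and x: "x \<in> hom D (FOb F a) (FOb F b)"
    for u v a b a' b' x
  proof -
    have ob: "a \<in> Ob C" "b \<in> Ob C" "a' \<in> Ob C" "b' \<in> Ob C"
      using u v F.C.Dom_Ob F.C.Cod_Ob by (auto simp: hom_def)
    \<comment> \<open>Condition (b) splits off \<open>FAr F v\<close> first and
      \<open>FAr F u\<close> second; condition (a) evaluates \<open>P\<close> on these two outer
      factors.\<close>
    show ?thesis
      using P_Comp[OF ob(3,2,4) F.D.Comp_hom[OF F.FAr_hom[OF u] x] F.FAr_hom[OF v]]
        P_Comp[OF ob(3,1,2) F.FAr_hom[OF u] x] P_FAr[OF ob(3,1) u] P_FAr[OF ob(2,4) v]
      by simp
  qed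
  have "set_nat_transform (prod_cat (op_cat C) C) (hom_fctr D F) (hom_fctr X I) P"
    unfolding set_nat_transform_def set_nat_transform_axioms_def
  proof (intro conjI allI impI)
    fix ab assume "ab \<in> Ob (prod_cat (op_cat C) C)"
    then show "P ab \<in> SOb (hom_fctr D F) ab \<rightarrow> SOb (hom_fctr X I) ab"
      by (auto simp: prod_cat_def op_cat_def hom_fctr_def P_hom)
  next
    fix uv ab ab' x
    assume "uv \<in> hom (prod_cat (op_cat C) C) ab ab'" "x \<in> SOb (hom_fctr D F) ab"
    then show "P ab' (SAr (hom_fctr D F) uv x) = SAr (hom_fctr X I) uv (P ab x)"
      by (cases uv, cases ab, cases ab')
        (auto simp: hom_def prod_cat_def op_cat_def hom_fctr_def intro!: natural)
  qed (fact set_functor_hom_fctr[OF F] set_functor_hom_fctr[OF I])+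
  with P_FAr P_Comp show ?thesis
    unfolding heavily_separable_def by (intro exI[of _ P]) simp
qed

context adjunction
begin

lemma unit_hom: "a \<in> Ob C \<Longrightarrow> \<eta> a \<in> hom C a (FOb G (FOb F a))"
  using unit.component by (simp add: id_fctr_def comp_fctr_def)

lemma counit_hom: "d \<in> Ob D \<Longrightarrow> \<epsilon> d \<in> hom D (FOb F (FOb G d)) d"
  using counit.component by (simp add: id_fctr_def comp_fctr_def)

lemma counit_natural: "g \<in> hom D d e \<Longrightarrow> \<epsilon> e \<cdot>\<^bsub>D\<^esub> FAr F (FAr G g) = g \<cdot>\<^bsub>D\<^esub> \<epsilon> d"
  using counit.naturality by (simp add: id_fctr_def comp_fctr_def)

lemma left_transpose_hom:
  "\<lbrakk>d \<in> Ob D; k \<in> hom C a (FOb G d)\<rbrakk> \<Longrightarrow> \<epsilon> d \<cdot>\<^bsub>D\<^esub> FAr F k \<in> hom D (FOb F a) d"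
  by (meson F.D.Comp_hom F.FAr_hom counit_hom)

lemma right_transpose_hom:
  "\<lbrakk>a \<in> Ob C; g \<in> hom D (FOb F a) d\<rbrakk> \<Longrightarrow> FAr G g \<cdot>\<^bsub>C\<^esub> \<eta> a \<in> hom C a (FOb G d)"
  by (meson F.C.Comp_hom G.FAr_hom unit_hom)

text \<open>Left transposition is natural in \<open>d\<close>: functoriality of \<open>F\<close>
  isolates \<open>FAr F (FAr G g)\<close>, and naturality of \<epsilon> at \<open>g\<close> moves it
  across the counit.\<close>

lemma left_transpose_Comp:
  assumes k: "k \<in> hom C a (FOb G d)" and g: "g \<in> hom D d e"
  shows "\<epsilon> e \<cdot>\<^bsub>D\<^esub> FAr F (FAr G g \<cdot>\<^bsub>C\<^esub> k) = g \<cdot>\<^bsub>D\<^esub> (\<epsilon> d \<cdot>\<^bsub>D\<^esub> FAr F k)"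
proof -
  have de: "d \<in> Ob D" "e \<in> Ob D"
    using g F.D.Dom_Ob F.D.Cod_Ob by (auto simp: hom_def)
  note Gg = G.FAr_hom[OF g]
  have "\<epsilon> e \<cdot>\<^bsub>D\<^esub> FAr F (FAr G g \<cdot>\<^bsub>C\<^esub> k) = \<epsilon> e \<cdot>\<^bsub>D\<^esub> FAr F (FAr G g) \<cdot>\<^bsub>D\<^esub> FAr F k"
    by (simp add: F.FAr_Comp[OF k Gg])
  also have "\<dots> = (\<epsilon> e \<cdot>\<^bsub>D\<^esub> FAr F (FAr G g)) \<cdot>\<^bsub>D\<^esub> FAr F k"
    by (rule F.D.Comp_assoc[OF F.FAr_hom[OF k] F.FAr_hom[OF Gg] counit_hom[OF de(2)], symmetric])
  also have "\<dots> = (g \<cdot>\<^bsub>D\<^esub> \<epsilon> d) \<cdot>\<^bsub>D\<^esub> FAr F k"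
    by (simp add: counit_natural[OF g])
  also have "\<dots> = g \<cdot>\<^bsub>D\<^esub> (\<epsilon> d \<cdot>\<^bsub>D\<^esub> FAr F k)"
    by (rule F.D.Comp_assoc[OF F.FAr_hom[OF k] counit_hom[OF de(1)] g])
  finally show ?thesis .
qed

text \<open>The case \<open>k = \<eta> a\<close> of \<open>left_transpose_Comp\<close>, where the
  triangle identity for \<open>F\<close> cancels the unit against the counit.\<close>

lemma left_right_transpose:
  assumes a: "a \<in> Ob C" and g: "g \<in> hom D (FOb F a) d"
  shows "\<epsilon> d \<cdot>\<^bsub>D\<^esub> FAr F (FAr G g \<cdot>\<^bsub>C\<^esub> \<eta> a) = g"
  using left_transpose_Comp[OF unit_hom[OF a] g] triangle_F[OF a] F.D.Comp_Ident[OF g] by simp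

end

locale adjunction_pair =
  adjunction C D F G \<eta> \<epsilon> + A': adjunction C D' F' G' \<eta>' \<epsilon>'
  for C :: "('oc, 'ac) cat" and D :: "('od, 'ad) cat" and F G \<eta> \<epsilon>
    and D' :: "('oe, 'ae) cat" and F' G' \<eta>' \<epsilon>' +
  assumes same_monad: "monad_eq C (monad_of_adjunction F' G' \<eta>' \<epsilon>') (monad_of_adjunction F G \<eta> \<epsilon>)"
begin

lemma
  shows same_FOb: "a \<in> Ob C \<Longrightarrow> FOb G' (FOb F' a) = FOb G (FOb F a)"
    and same_FAr: "f \<in> hom C a b \<Longrightarrow> FAr G' (FAr F' f) = FAr G (FAr F f)"
    and same_Mult: "a \<in> Ob C \<Longrightarrow> FAr G' (\<epsilon>' (FOb F' a)) = FAr G (\<epsilon> (FOb F a))"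
    and same_Unity: "a \<in> Ob C \<Longrightarrow> \<eta>' a = \<eta> a"
  using same_monad by (auto simp: monad_eq_def monad_of_adjunction_def comp_fctr_def hom_def)

text \<open>The map \<open>K\<close> of the overview: right transpose along \<open>(F', G')\<close>,
  then left transpose along \<open>(F, G)\<close>. The unit \<open>\<eta>\<close> serves both
  adjunctions, as \<open>\<eta>'\<close> agrees with it on objects of \<open>C\<close>.\<close>

definition transfer :: "'oc \<Rightarrow> 'oc \<Rightarrow> 'ae \<Rightarrow> 'ad" where
  "transfer a b h = \<epsilon> (FOb F b) \<cdot>\<^bsub>D\<^esub> FAr F (FAr G' h \<cdot>\<^bsub>C\<^esub> \<eta> a)"

lemma right_transpose'_hom:
  "\<lbrakk>a \<in> Ob C; b \<in> Ob C; h \<in> hom D' (FOb F' a) (FOb F' b)\<rbrakk>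
    \<Longrightarrow> FAr G' h \<cdot>\<^bsub>C\<^esub> \<eta> a \<in> hom C a (FOb G (FOb F b))"
  using A'.right_transpose_hom same_FOb same_Unity by metis

lemma transfer_hom:
  "\<lbrakk>a \<in> Ob C; b \<in> Ob C; h \<in> hom D' (FOb F' a) (FOb F' b)\<rbrakk>
    \<Longrightarrow> transfer a b h \<in> hom D (FOb F a) (FOb F b)"
  unfolding transfer_def by (simp add: left_transpose_hom F.FOb_Ob right_transpose'_hom)

text \<open>Under \<open>G\<close>, the left transpose of \<open>k\<close> involves only the
  multiplication and \<open>GF\<close> on arrows, which both adjunctions share. So \<open>G\<close>
  can be traded for \<open>G'\<close>, with the left transpose now taken along
  \<open>(F', G')\<close>.\<close>

lemma FAr_transfer:
  assumes a: "a \<in> Ob C" and b: "b \<in> Ob C" and h: "h \<in> hom D' (FOb F' a) (FOb F' b)"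
  shows "FAr G (transfer a b h) = FAr G' h"
proof -
  define k where "k = FAr G' h \<cdot>\<^bsub>C\<^esub> \<eta> a"
  have k: "k \<in> hom C a (FOb G (FOb F b))" and k': "k \<in> hom C a (FOb G' (FOb F' b))"
    using right_transpose'_hom[OF a b h] by (simp_all add: k_def same_FOb[OF b])
  have "FAr G (transfer a b h) = FAr G (\<epsilon> (FOb F b)) \<cdot>\<^bsub>C\<^esub> FAr G (FAr F k)"
    unfolding transfer_def k_def[symmetric]
    by (rule G.FAr_Comp[OF F.FAr_hom[OF k] counit_hom[OF F.FOb_Ob[OF b]]])
  also have "\<dots> = FAr G' (\<epsilon>' (FOb F' b)) \<cdot>\<^bsub>C\<^esub> FAr G' (FAr F' k)"
    by (simp add: same_Mult[OF b] same_FAr[OF k])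
  also have "\<dots> = FAr G' (\<epsilon>' (FOb F' b) \<cdot>\<^bsub>D'\<^esub> FAr F' k)"
    by (rule A'.G.FAr_Comp[symmetric, OF A'.F.FAr_hom[OF k'] A'.counit_hom[OF A'.F.FOb_Ob[OF b]]])
  \<comment> \<open>As \<open>\<eta> a = \<eta>' a\<close>, \<open>k\<close> is the right transpose
    of \<open>h\<close> in the primed adjunction, and transposing back returns
    \<open>h\<close>.\<close>
  also have "\<epsilon>' (FOb F' b) \<cdot>\<^bsub>D'\<^esub> FAr F' k = h"
    using A'.left_right_transpose[OF a h] by (simp add: k_def same_Unity[OF a])
  finally show ?thesis .
qed

text \<open>Since \<open>G'F'f = GFf\<close>, both transpositions are those of \<open>(F, G)\<close>
  applied to \<open>FAr F f\<close>, and they cancel.\<close>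

lemma transfer_FAr:
  assumes f: "f \<in> hom C a b"
  shows "transfer a b (FAr F' f) = FAr F f"
proof -
  have "a \<in> Ob C"
    using f F.C.Dom_Ob by (auto simp: hom_def)
  then show ?thesis
    using left_right_transpose F.FAr_hom[OF f] by (simp add: transfer_def same_FAr[OF f])
qed

text \<open>\<open>FAr_transfer\<close> rewrites \<open>G' g\<close> as \<open>G\<close> of an arrow
  of \<open>D\<close>, which \<open>left_transpose_Comp\<close> then pulls out of the
  transpose.\<close>

lemma transfer_Comp:
  assumes a: "a \<in> Ob C" and b: "b \<in> Ob C" and c: "c \<in> Ob C"
    and h: "h \<in> hom D' (FOb F' a) (FOb F' b)" and g: "g \<in> hom D' (FOb F' b) (FOb F' c)"
  shows "transfer a c (g \<cdot>\<^bsub>D'\<^esub> h) = transfer b c g \<cdot>\<^bsub>D\<^esub> transfer a b h"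
proof -
  have eta: "\<eta> a \<in> hom C a (FOb G' (FOb F' a))"
    by (simp add: same_FOb[OF a] unit_hom[OF a])
  have "FAr G' (g \<cdot>\<^bsub>D'\<^esub> h) \<cdot>\<^bsub>C\<^esub> \<eta> a = (FAr G' g \<cdot>\<^bsub>C\<^esub> FAr G' h) \<cdot>\<^bsub>C\<^esub> \<eta> a"
    by (simp add: A'.G.FAr_Comp[OF h g])
  also have "\<dots> = FAr G' g \<cdot>\<^bsub>C\<^esub> FAr G' h \<cdot>\<^bsub>C\<^esub> \<eta> a"
    by (rule F.C.Comp_assoc[OF eta A'.G.FAr_hom[OF h] A'.G.FAr_hom[OF g]])
  also have "\<dots> = FAr G (transfer b c g) \<cdot>\<^bsub>C\<^esub> FAr G' h \<cdot>\<^bsub>C\<^esub> \<eta> a"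
    by (simp add: FAr_transfer[OF b c g])
  finally show ?thesis
    using left_transpose_Comp[OF right_transpose'_hom[OF a b h] transfer_hom[OF b c g]]
    by (simp add: transfer_def)
qed

lemma heavily_separable_transfer:
  assumes I: "cat_functor C X I" and sep: "heavily_separable C D X F I"
  shows "heavily_separable C D' X F' I"
proof -
  obtain P where
    P: "set_nat_transform (prod_cat (op_cat C) C) (hom_fctr D F) (hom_fctr X I) P"
    and P_FAr: "\<And>a b f. \<lbrakk>a \<in> Ob C; b \<in> Ob C; f \<in> hom C a b\<rbrakk> \<Longrightarrow> P (a, b) (FAr F f) = FAr I f"
    and P_Comp: "\<And>a b c f g. \<lbrakk>a \<in> Ob C; b \<in> Ob C; c \<in> Ob C;
      f \<in> hom D (FOb F a) (FOb F b); g \<in> hom D (FOb F b) (FOb F c)\<rbrakk>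
      \<Longrightarrow> P (a, c) (g \<cdot>\<^bsub>D\<^esub> f) = P (b, c) g \<cdot>\<^bsub>X\<^esub> P (a, b) f"
    using sep unfolding heavily_separable_def by blast
  have P_hom: "P (a, b) f \<in> hom X (FOb I a) (FOb I b)"
    if "a \<in> Ob C" "b \<in> Ob C" "f \<in> hom D (FOb F a) (FOb F b)" for a b f
    using set_nat_transform.component[OF P, of "(a, b)"] that
    by (auto simp: prod_cat_def op_cat_def hom_fctr_def)
  show ?thesis
    \<comment> \<open>Naturality of the composite with \<open>transfer\<close> needs no separate
      check: the introduction rule derives it.\<close>
    by (rule heavily_separableI[OF A'.F.cat_functor_axioms I,
          where P = "\<lambda>(a, b) h. P (a, b) (transfer a b h)"])
      (simp_all add: P_hom P_FAr P_Comp transfer_hom transfer_FAr transfer_Comp)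
qed

end

lemma heavily_separable_monad_adjunction:
  assumes "adjunction C D F G \<eta> \<epsilon>" "cat_functor C X I" "heavily_separable C D X F I"
    and "monad_adjunction C (monad_of_adjunction F G \<eta> \<epsilon>) D' F' G' \<eta>' \<epsilon>'"
  shows "heavily_separable C D' X F' I"
proof -
  interpret adjunction_pair C D F G \<eta> \<epsilon> D' F' G' \<eta>' \<epsilon>'
    using assms(1,4) by (simp add: adjunction_pair_def adjunction_pair_axioms_def monad_adjunction_def)
  show ?thesis
    using assms(2,3) by (rule heavily_separable_transfer)
qed

theorem proposition4p1:
  fixes C :: "('oc, 'ac) cat" and D :: "('od, 'ad) cat" and X :: "('ox, 'ax) cat"
    and F :: "('oc, 'ac, 'od, 'ad) fctr" and G :: "('od, 'ad, 'oc, 'ac) fctr"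
    and I :: "('oc, 'ac, 'ox, 'ax) fctr"
    and \<eta> :: "'oc \<Rightarrow> 'ac" and \<epsilon> :: "'od \<Rightarrow> 'ad"
    and T :: "('oc, 'ac) mnd"
  assumes "adjunction C D F G \<eta> \<epsilon>"
    and "cat_functor C X I"
    and "T = monad_of_adjunction F G \<eta> \<epsilon>"
  shows
    \<comment> \<open>HOL cannot quantify over types within a formula. In the equivalence the category \<open>D'\<close> ranges
      over all categories on the types of \<open>D\<close>; the second conjunct gives (1) implies (2) for \<open>D'\<close>
      on arbitrary types \<open>'oe\<close>, \<open>'ae\<close>.\<close>
    "(heavily_separable C D X F I \<longleftrightarrow>
        (\<forall>(D' :: ('od, 'ad) cat) F' G' \<eta>' \<epsilon>'.
          monad_adjunction C T D' F' G' \<eta>' \<epsilon>' \<longrightarrow> heavily_separable C D' X F' I)) \<and>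
     (heavily_separable C D X F I \<longrightarrow>
        (\<forall>(D' :: ('oe, 'ae) cat) F' G' \<eta>' \<epsilon>'.
          monad_adjunction C T D' F' G' \<eta>' \<epsilon>' \<longrightarrow> heavily_separable C D' X F' I))"
proof -
  \<comment> \<open>For (2) implies (1), the given adjunction is itself a
    \<open>T\<close>-adjunction.\<close>
  have "monad_adjunction C T D F G \<eta> \<epsilon>"
    using assms(1,3) by (simp add: monad_adjunction_def monad_eq_def)
  then show ?thesis
    unfolding assms(3) by (blast intro: heavily_separable_monad_adjunction[OF assms(1,2)])
qed

end
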